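(* For all integers $r,s\ge1$ and $N\ge2$ and all real $\rho>0$, $$\mu_{(r/(r+s),\,s/(r+s))}^{(N)}=\lim_{M\to\infty}\mu_{[r,s]}^{(M)},$$ and the common value is $$\frac{3rs(1-\rho)^3(1+\rho)}{9r^2(1+\rho)^2(1+\rho^2)+9rs(1+\rho)^2(1+\rho^2)+2s^2(1+\rho+\rho^2)^2}.$$ Here $\mu_{(\gamma,1-\gamma)}^{(N)}$ is the mean profit per turn of $N$ players in the random mixture $\gamma A'+(1-\gamma)B$, and $\mu_{[r,s]}^{(M)}$ is the mean profit per turn of $M$ players in the nonrandom pattern $(A')^rB^s$, as defined in the context.
   Context: The model. For an integer $N\ge2$, there are $N$ players, each having an integer capital. For a parameter $\rho>0$ put $$p_0:=\frac{\rho^2}{1+\rho^2},\qquad p_1=p_2:=\frac1{1+\rho},\qquad q_j:=1-p_j\quad(j=0,1,2).$$ Game $B$: one of the $N$ players is selected uniformly at random; if his current capital is congruent to $j$ (mod 3), $j\in\{0,1,2\}$, he wins one unit with probability $p_j$ and loses one unit with probability $q_j$. Game $A'$: two distinct players are selected uniformly at random without replacement, and the first transfers one unit of his capital to the second. Random mixture $\gamma A'+(1-\gamma)B$, $0<\gamma<1$: at each turn, independently of the past, game $A'$ is played with probability $\gamma$ and game $B$ with probability $1-\gamma$. Nonrandom pattern $[r,s]$, for integers $r,s\ge1$: game $A'$ is played $r$ times, then game $B$ is played $s$ times, and this pattern of $r+s$ turns is repeated forever, random choices at different turns being independent given the current capitals. In either setting, let $S_n$ be the total change in the sum of all players' capitals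 over the first $n$ turns (each play of $B$ contributes $\pm1$, each play of $A'$ contributes $0$). The mean profit per turn is $\lim_{n\to\infty}n^{-1}\mathrm{E}[S_n]$, which exists and does not depend on the initial capitals. It is denoted by $\mu_{(\gamma,1-\gamma)}^{(N)}$ for the random mixture with $N$ players and by $\mu_{[r,s]}^{(N)}$ for the nonrandom pattern with $N$ players. *)

theory Defs
  imports "HOL-Probability.Probability"
begin

text \<open>
  The players are \<open>0, \<dots>, N - 1\<close>; only the values of a capital function on \<open>{..<N}\<close> matter.
\<close>

type_synonym capitals = "nat \<Rightarrow> int"

definition win_prob :: "real \<Rightarrow> int \<Rightarrow> real" where
  "win_prob \<rho> c = (if c mod 3 = 0 then \<rho>\<^sup>2 / (1 + \<rho>\<^sup>2) else 1 / (1 + \<rho>))"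

definition game_B :: "real \<Rightarrow> nat \<Rightarrow> capitals \<Rightarrow> capitals pmf" where
  "game_B \<rho> N x =
     bind_pmf (pmf_of_set {..<N}) (\<lambda>i.
     bind_pmf (bernoulli_pmf (win_prob \<rho> (x i))) (\<lambda>win.
     return_pmf (x(i := x i + (if win then 1 else - 1)))))"

definition game_A' :: "nat \<Rightarrow> capitals \<Rightarrow> capitals pmf" where
  "game_A' N x =
     bind_pmf (pmf_of_set {(i, j). i < N \<and> j < N \<and> i \<noteq> j}) (\<lambda>(i, j).
     return_pmf (x(i := x i - 1, j := x j + 1)))"

text \<open>
  A strategy gives, for each turn \<open>n = 0, 1, \<dots>\<close>, the transition kernel of that turn.
\<close>

type_synonym strategy = "nat \<Rightarrow> capitals \<Rightarrow> capitals pmf"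

definition random_mixture :: "real \<Rightarrow> real \<Rightarrow> nat \<Rightarrow> strategy" where
  "random_mixture \<rho> \<gamma> N n x =
     bind_pmf (bernoulli_pmf \<gamma>) (\<lambda>a. if a then game_A' N x else game_B \<rho> N x)"

definition nonrandom_pattern :: "real \<Rightarrow> nat \<Rightarrow> nat \<Rightarrow> nat \<Rightarrow> strategy" where
  "nonrandom_pattern \<rho> r s N n x = (if n mod (r + s) < r then game_A' N x else game_B \<rho> N x)"

primrec capitals_after :: "strategy \<Rightarrow> capitals \<Rightarrow> nat \<Rightarrow> capitals pmf" where
  "capitals_after K x 0 = return_pmf x"
| "capitals_after K x (Suc n) = bind_pmf (capitals_after K x n) (K n)"

definition expected_profit :: "strategy \<Rightarrow> nat \<Rightarrow> capitals \<Rightarrow> nat \<Rightarrow> real" where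
  "expected_profit K N x n =
     measure_pmf.expectation (capitals_after K x n)
       (\<lambda>y. real_of_int ((\<Sum>i<N. y i) - (\<Sum>i<N. x i)))"

definition has_mean_profit :: "strategy \<Rightarrow> nat \<Rightarrow> real \<Rightarrow> bool" where
  "has_mean_profit K N m \<longleftrightarrow> (\<forall>x. (\<lambda>n. expected_profit K N x n / real n) \<longlonglongrightarrow> m)"

definition mean_profit :: "strategy \<Rightarrow> nat \<Rightarrow> real" where
  "mean_profit K N = (THE m. has_mean_profit K N m)"

definition mu_mixture :: "real \<Rightarrow> real \<Rightarrow> nat \<Rightarrow> real" where
  "mu_mixture \<rho> \<gamma> N = mean_profit (random_mixture \<rho> \<gamma> N) N"

definition mu_pattern :: "real \<Rightarrow> nat \<Rightarrow> nat \<Rightarrow> nat \<Rightarrow> real" where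
  "mu_pattern \<rho> r s N = mean_profit (nonrandom_pattern \<rho> r s N) N"

end

theory Submission
  imports Defs
begin

text \<open>
  In either game the marginal law of one player's step depends only on his own capital, so the
  expectation of a symmetric sum \<open>\<Sum>i. f (X i)\<close> evolves by a linear one-player operator
  \<open>f \<mapsto> f + drift f / N\<close> acting on \<open>f\<close>. If \<open>u\<close> stays within bounded distance of the identity and
  solves the Poisson equation \<open>P u = u + a\<close>, where \<open>P\<close> is the operator of a whole period of length
  \<open>L\<close>, then telescoping gives the mean profit \<open>N a / L\<close>; an error \<open>\<epsilon>\<close> in the equation costs at most
  \<open>N \<epsilon> / L\<close>.

  For the mixture the equation is a \<open>3 \<times> 3\<close> linear system that does not involve \<open>N\<close> apart from the
  factor \<open>1 / N\<close>, and it is solved explicitly. For the pattern the period operator is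
  \<open>1 + (r D\<^sub>A + s D\<^sub>B) / M + O(1 / M\<^sup>2)\<close>, so the same \<open>u\<close> satisfies its Poisson equation up to
  \<open>O(1 / M\<^sup>2)\<close>, and the mean profits differ by \<open>O(1 / M)\<close>. Existence of the mean profit for fixed
  \<open>M\<close> follows because \<open>A'\<close> contracts 3-periodic functions modulo constants by \<open>\<bar>1 - 3 / M\<bar> < 1\<close>.
\<close>

section \<open>Linear evolution of symmetric sums\<close>

text \<open>\<open>up n c / N\<close> and \<open>dn n c / N\<close> are the probabilities that a given player with capital \<open>c\<close> gains,
  respectively loses, one unit at turn \<open>n\<close>.\<close>

definition drift :: "(int \<Rightarrow> real) \<Rightarrow> (int \<Rightarrow> real) \<Rightarrow> (int \<Rightarrow> real) \<Rightarrow> int \<Rightarrow> real" where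
  "drift up dn f c = up c * (f (c + 1) - f c) + dn c * (f (c - 1) - f c)"

text \<open>The common interface of both strategies. The rates \<open>up\<close> and
  \<open>dn\<close> are not divided by \<open>N\<close>, so they can stay fixed while
  \<open>N\<close> varies. By \<open>up_dn_le\<close> one turn is a convex average, and by
  \<open>expectation_K\<close> sums of one-player functions evolve among themselves.\<close>

locale marginal_chain =
  fixes K :: strategy and N L :: nat and up dn :: "nat \<Rightarrow> int \<Rightarrow> real"
  assumes N_pos: "N > 0" and L_pos: "L > 0"
    and up_nonneg: "up n c \<ge> 0" and dn_nonneg: "dn n c \<ge> 0"
    and up_dn_le: "up n c + dn n c \<le> real N"
    and up_period: "up (n + L) = up n" and dn_period: "dn (n + L) = dn n"
    and up_mod3: "up n (c + 3) = up n c" and dn_mod3: "dn n (c + 3) = dn n c"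
    and finite_K: "finite (set_pmf (K n x))"
    and expectation_K: "measure_pmf.expectation (K n x) (\<lambda>z. \<Sum>i<N. f (z i)) =
      (\<Sum>i<N. f (x i) + drift (up n) (dn n) f (x i) / real N)"
begin

definition T :: "nat \<Rightarrow> (int \<Rightarrow> real) \<Rightarrow> int \<Rightarrow> real" where
  "T n f c = f c + drift (up n) (dn n) f c / real N"

text \<open>The action is dual: the latest turn is applied first, so turn 0 is the outermost
  factor.\<close>

primrec pull :: "nat \<Rightarrow> (int \<Rightarrow> real) \<Rightarrow> int \<Rightarrow> real" where
  "pull 0 f = f"
| "pull (Suc n) f = pull n (T n f)"

lemma T_convex:
  "T n f c = (1 - (up n c + dn n c) / N) * f c + up n c / N * f (c + 1) + dn n c / N * f (c - 1)"
  using N_pos by (simp add: T_def drift_def field_simps)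

lemma T_mono: "(\<And>c. f c \<le> g c) \<Longrightarrow> T n f c \<le> T n g c"
  unfolding T_convex using N_pos up_nonneg[of n c] dn_nonneg[of n c] up_dn_le[of n c]
  by (intro add_mono mult_left_mono) (auto simp: field_simps)

lemma T_add_const: "T n (\<lambda>c. f c + k) = (\<lambda>c. T n f c + k)"
  by (rule ext) (simp add: T_def drift_def)

lemma T_add_scaled: "T n (\<lambda>c. f c + k * g c) = (\<lambda>c. T n f c + k * T n g c)"
  by (rule ext) (simp add: T_def drift_def algebra_simps add_divide_distrib diff_divide_distrib)

text \<open>The case \<open>k = 3\<close> serves the identity, \<open>k = 0\<close> the 3-periodic
  functions.\<close>

lemma T_shift3: "(\<And>c. f (c + 3) = f c + k) \<Longrightarrow> T n f (c + 3) = T n f c + k"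
proof -
  assume f: "\<And>c. f (c + 3) = f c + k"
  have "f (c + 3 + 1) = f (c + 1) + k" "f (c + 3 - 1) = f (c - 1) + k"
    using f[of "c + 1"] f[of "c - 1"] by (simp_all add: algebra_simps)
  then show ?thesis
    by (simp add: T_def drift_def up_mod3 dn_mod3 f)
qed

lemma pull_mono: "(\<And>c. f c \<le> g c) \<Longrightarrow> pull n f c \<le> pull n g c"
  by (induction n arbitrary: f g) (simp_all add: T_mono)

lemma pull_add_const: "pull n (\<lambda>c. f c + k) = (\<lambda>c. pull n f c + k)"
  by (induction n arbitrary: f) (simp_all add: T_add_const)

lemma pull_add_scaled: "pull n (\<lambda>c. f c + k * g c) = (\<lambda>c. pull n f c + k * pull n g c)"
  by (induction n arbitrary: f g) (simp_all add: T_add_scaled)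

lemma pull_diff: "pull n (\<lambda>c. f c - g c) = (\<lambda>c. pull n f c - pull n g c)"
  using pull_add_scaled[of n f "-1" g] by simp

text \<open>A monotone operator that commutes with adding constants does not increase sup
  distance.\<close>

lemma pull_close:
  assumes "\<And>c. \<bar>f c - g c\<bar> \<le> e"
  shows "\<bar>pull n f c - pull n g c\<bar> \<le> e"
proof -
  have "pull n f c \<le> pull n (\<lambda>c. g c + e) c" "pull n g c \<le> pull n (\<lambda>c. f c + e) c"
    by (intro pull_mono; use assms in \<open>smt (verit)\<close>)+
  then show ?thesis by (simp add: pull_add_const)
qed

text \<open>Telescoping: including turn \<open>n\<close> replaces \<open>f\<close> by
  \<open>T n f\<close> inside the nonexpansive \<open>pull n\<close>, at a cost of at most
  \<open>e\<close>.\<close>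

lemma pull_near:
  assumes "\<And>n c. \<bar>T n f c - f c\<bar> \<le> e"
  shows "\<bar>pull n f c - f c\<bar> \<le> n * e"
proof (induction n)
  case (Suc n)
  have "\<bar>pull n (T n f) c - pull n f c\<bar> \<le> e"
    by (intro pull_close assms)
  with Suc show ?case by (simp add: algebra_simps)
qed simp

lemma T_id_near: "\<bar>T n real_of_int c - real_of_int c\<bar> \<le> 1"
proof -
  have "T n real_of_int c - real_of_int c = (up n c - dn n c) / N"
    by (simp add: T_def drift_def)
  moreover have "\<bar>up n c - dn n c\<bar> \<le> N"
    using up_nonneg[of n c] dn_nonneg[of n c] up_dn_le[of n c] by linarith
  ultimately show ?thesis using N_pos by simp
qed

lemma pull_shift3: "(\<And>c. f (c + 3) = f c + k) \<Longrightarrow> pull n f (c + 3) = pull n f c + k"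
  by (induction n arbitrary: f) (simp_all add: T_shift3)

abbreviation P :: "(int \<Rightarrow> real) \<Rightarrow> int \<Rightarrow> real" where
  "P \<equiv> pull L"

text \<open>Since turn \<open>n + L\<close> acts like turn \<open>n\<close>, the first period splits
  off as an outer factor.\<close>

lemma pull_L_add: "pull (n + L) f = P (pull n f)"
proof (induction n arbitrary: f)
  case (Suc n)
  have "T (n + L) f = T n f"
    by (simp add: T_def[abs_def] up_period dn_period)
  with Suc show ?case by simp
qed simp

lemma pull_L_mult: "pull (k * L + n) f = (P ^^ k) (pull n f)"
proof (induction k)
  case (Suc k)
  have "pull (Suc k * L + n) f = pull ((k * L + n) + L) f"
    by (simp add: algebra_simps)
  then show ?case by (simp only: pull_L_add Suc funpow.simps o_def)
qed simp

section \<open>Expectations along the chain\<close>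

lemma finite_capitals_after: "finite (set_pmf (capitals_after K x n))"
  by (induction n) (simp_all add: finite_K)

text \<open>Conditioning on the state before the last turn changes \<open>f\<close> into
  \<open>T n f\<close>, so the induction must vary \<open>f\<close>.\<close>

lemma expectation_capitals_after:
  "measure_pmf.expectation (capitals_after K x n) (\<lambda>z. \<Sum>i<N. f (z i)) = (\<Sum>i<N. pull n f (x i))"
proof (induction n arbitrary: f)
  case (Suc n)
  let ?p = "capitals_after K x n"
  have "measure_pmf.expectation (bind_pmf ?p (K n)) (\<lambda>z. \<Sum>i<N. f (z i)) =
      (\<Sum>y\<in>set_pmf ?p. pmf ?p y *\<^sub>R measure_pmf.expectation (K n y) (\<lambda>z. \<Sum>i<N. f (z i)))"
    by (rule pmf_expectation_bind) (auto simp: finite_capitals_after finite_K)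
  also have "\<dots> = (\<Sum>y\<in>set_pmf ?p. pmf ?p y *\<^sub>R (\<Sum>i<N. T n f (y i)))"
    by (simp only: expectation_K T_def)
  also have "\<dots> = measure_pmf.expectation ?p (\<lambda>y. \<Sum>i<N. T n f (y i))"
    by (subst integral_measure_pmf[of "set_pmf ?p"]) (auto simp: finite_capitals_after)
  finally show ?case by (simp add: Suc)
qed simp

lemma expected_profit_pull:
  "expected_profit K N x n = (\<Sum>i<N. pull n real_of_int (x i) - real_of_int (x i))"
proof -
  have "expected_profit K N x n = measure_pmf.expectation (capitals_after K x n)
      (\<lambda>y. (\<Sum>i<N. real_of_int (y i)) - (\<Sum>i<N. real_of_int (x i)))"
    by (simp add: expected_profit_def)
  also have "\<dots> = (\<Sum>i<N. pull n real_of_int (x i)) - (\<Sum>i<N. real_of_int (x i))"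
    using expectation_capitals_after[of x n real_of_int]
    by (subst Bochner_Integration.integral_diff)
      (auto intro!: integrable_measure_pmf_finite finite_capitals_after)
  finally show ?thesis by (simp add: sum_subtractf)
qed

section \<open>Approximate Poisson equations\<close>

text \<open>Only the defect \<open>e\<close> accumulates with \<open>n\<close>. The bounded part
  collects \<open>L\<close> for an incomplete period, \<open>2 * b\<close> for exchanging the
  identity with \<open>u\<close> at both ends, and the modulus of \<open>a\<close> for rounding
  \<open>n / L\<close> down to \<open>k\<close>.\<close>

lemma pull_id_bound:
  fixes a b d e :: real
  assumes Pu: "\<And>c. \<bar>P u c - u c - a\<bar> \<le> e" and u: "\<And>c. \<bar>u c - real_of_int c\<bar> \<le> b"
  shows "\<bar>pull n real_of_int c - c - n * (a / L)\<bar> \<le> n * (e / L) + (L + 2 * b + \<bar>a\<bar>)"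
proof -
  define k where "k = n div L"
  define j where "j = n mod L"
  have n: "n = k * L + j" by (simp add: k_def j_def)
  have j: "j \<le> L" using L_pos by (simp add: j_def less_imp_le)
  have e: "e \<ge> 0" using Pu[of 0] by linarith
  have pow_close: "\<bar>(P ^^ k) f c - (P ^^ k) g c\<bar> \<le> e" if "\<And>c. \<bar>f c - g c\<bar> \<le> e" for f g k e c
    using that by (induction k arbitrary: c) (simp_all add: pull_close)
  \<comment> \<open>Applying \<open>P\<close> to the approximation \<open>u + k * a\<close> adds
    \<open>a\<close> with one further error \<open>e\<close>; earlier errors do not grow.\<close>
  have 1: "\<bar>(P ^^ k) u c - u c - k * a\<bar> \<le> k * e" for k c
  proof (induction k arbitrary: c)
    case (Suc k)
    have "\<bar>P ((P ^^ k) u) c - P (\<lambda>c. u c + k * a) c\<bar> \<le> k * e"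
      by (rule pull_close) (use Suc in \<open>simp add: algebra_simps\<close>)
    with Pu[of c] show ?case by (simp add: pull_add_const algebra_simps)
  qed simp
  have "\<bar>pull j real_of_int c - c\<bar> \<le> L" for c
    using pull_near[of real_of_int 1 j c] T_id_near j by simp
  then have 2: "\<bar>pull n real_of_int c - (P ^^ k) real_of_int c\<bar> \<le> L"
    unfolding n pull_L_mult by (rule pow_close)
  have 3: "\<bar>(P ^^ k) u c - (P ^^ k) real_of_int c\<bar> \<le> b"
    by (rule pow_close) (rule u)
  have ka: "n * (a / L) = k * a + j / L * a"
    using L_pos by (simp add: n field_simps)
  have "\<bar>j / L * a\<bar> \<le> 1 * \<bar>a\<bar>"
    unfolding abs_mult by (rule mult_right_mono) (use j L_pos in \<open>auto simp: field_simps\<close>)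
  moreover have "k * e \<le> n * (e / L)"
    using L_pos e by (simp add: n field_simps)
  moreover have "\<bar>pull n real_of_int c - c - k * a\<bar> \<le> L + 2 * b + k * e"
    using 1[of k c] 2 3 u[of c] by linarith
  ultimately show ?thesis unfolding ka by linarith
qed

lemma profit_bound:
  fixes a b d e :: real
  assumes "\<And>c. \<bar>P u c - u c - a\<bar> \<le> e" and "\<And>c. \<bar>u c - real_of_int c\<bar> \<le> b"
  shows "\<bar>expected_profit K N x n - n * (N * a / L)\<bar> \<le> n * (N * e / L) + N * (L + 2 * b + \<bar>a\<bar>)"
proof -
  have "expected_profit K N x n - n * (N * a / L) =
      (\<Sum>i<N. pull n real_of_int (x i) - x i - n * (a / L))"
    by (simp add: expected_profit_pull sum_subtractf)
  also have "\<bar>\<dots>\<bar> \<le> (\<Sum>i<N. \<bar>pull n real_of_int (x i) - x i - n * (a / L)\<bar>)"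
    by (rule sum_abs)
  also have "\<dots> \<le> (\<Sum>i<N. n * (e / L) + (L + 2 * b + \<bar>a\<bar>))"
    by (intro sum_mono pull_id_bound[where u = u] assms)
  finally show ?thesis by (simp add: algebra_simps)
qed

text \<open>Division by \<open>n\<close> removes the bounded part of the error; the slack
  \<open>d\<close> absorbs what is left of it for large \<open>n\<close>.\<close>

lemma profit_rate_bound:
  fixes a b d e :: real
  assumes "\<And>c. \<bar>P u c - u c - a\<bar> \<le> e" and "\<And>c. \<bar>u c - real_of_int c\<bar> \<le> b" and "d > 0"
  shows "\<forall>\<^sub>F n in sequentially. \<bar>expected_profit K N x n / n - N * a / L\<bar> \<le> N * e / L + d"
proof -
  define C where "C = N * (L + 2 * b + \<bar>a\<bar>)"
  have "(\<lambda>n. C / real n) \<longlonglongrightarrow> 0"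
    by (rule lim_const_over_n)
  then have "\<forall>\<^sub>F n in sequentially. C / real n < d"
    using \<open>d > 0\<close> by (rule order_tendstoD)
  then show ?thesis
    using eventually_gt_at_top[of 0]
  proof eventually_elim
    case (elim n)
    have "expected_profit K N x n / n - N * a / L = (expected_profit K N x n - n * (N * a / L)) / n"
      using elim(2) by (simp add: diff_divide_distrib)
    then have "\<bar>expected_profit K N x n / n - N * a / L\<bar> = \<bar>expected_profit K N x n - n * (N * a / L)\<bar> / n"
      by (simp add: abs_divide)
    also have "\<dots> \<le> (n * (N * e / L) + C) / n"
      unfolding C_def by (intro divide_right_mono profit_bound[where u = u] assms) simp
    also have "\<dots> = N * e / L + C / n"
      using elim(2) by (simp add: add_divide_distrib)
    finally show ?case using elim(1) by simp
  qed
qed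

lemma has_mean_profit_if_poisson:
  fixes a b d e :: real
  assumes "\<And>c. P u c = u c + a" and "\<And>c. \<bar>u c - real_of_int c\<bar> \<le> b"
  shows "has_mean_profit K N (N * a / L)"
  unfolding has_mean_profit_def
proof (intro allI tendstoI)
  fix x and d :: real assume "d > 0"
  then have "\<forall>\<^sub>F n in sequentially. \<bar>expected_profit K N x n / n - N * a / L\<bar> \<le> N * (0::real) / L + d / 2"
    using assms by (intro profit_rate_bound[where u = u and b = b]) auto
  then show "\<forall>\<^sub>F n in sequentially. dist (expected_profit K N x n / real n) (N * a / L) < d"
    by eventually_elim (use \<open>d > 0\<close> in \<open>simp add: dist_real_def\<close>)
qed

lemma mean_profit_close:
  fixes a b d e :: real
  assumes "has_mean_profit K N \<mu>"
    and "\<And>c. \<bar>P u c - u c - a\<bar> \<le> e" and "\<And>c. \<bar>u c - real_of_int c\<bar> \<le> b"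
  shows "\<bar>\<mu> - N * a / L\<bar> \<le> N * e / L"
proof (rule field_le_epsilon)
  fix d :: real assume "d > 0"
  have "(\<lambda>n. \<bar>expected_profit K N (\<lambda>_. 0) n / n - N * a / L\<bar>) \<longlonglongrightarrow> \<bar>\<mu> - N * a / L\<bar>"
    using assms(1) unfolding has_mean_profit_def by (intro tendsto_intros) auto
  then show "\<bar>\<mu> - N * a / L\<bar> \<le> N * e / L + d"
    using profit_rate_bound[OF assms(2,3) \<open>d > 0\<close>] by (rule tendsto_upperbound) simp
qed

text \<open>Each approximate solution confines the rates for all initial capitals to one short
  interval eventually. Hence they are Cauchy, and their limits agree.\<close>

lemma has_mean_profit_if_approx_poisson:
  assumes "\<And>e. e > 0 \<Longrightarrow> \<exists>u (a::real) b. (\<forall>c. \<bar>P u c - u c - a\<bar> \<le> e) \<and> (\<forall>c. \<bar>u c - real_of_int c\<bar> \<le> b)"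
  shows "\<exists>m. has_mean_profit K N m"
proof -
  define R where "R x n = expected_profit K N x n / n" for x n
  have rate: "\<exists>m. \<forall>x. \<forall>\<^sub>F n in sequentially. \<bar>R x n - m\<bar> < d" if "d > 0" for d
  proof -
    \<comment> \<open>With this defect the rate error is \<open>d / 4\<close>; the slack
      \<open>d / 4\<close> then leaves a total of \<open>d / 2\<close>, strictly below
      \<open>d\<close>.\<close>
    have "d * L / (4 * N) > 0" using that N_pos L_pos by simp
    then obtain u and a b :: real where u: "\<And>c. \<bar>P u c - u c - a\<bar> \<le> d * L / (4 * N)"
      "\<And>c. \<bar>u c - real_of_int c\<bar> \<le> b"
      using assms by blast
    have rate: "N * (d * L / (4 * N)) / L = d / 4"
      using N_pos L_pos by simp
    have near: "\<forall>\<^sub>F n in sequentially.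
        \<bar>expected_profit K N x n / n - N * a / L\<bar> \<le> N * (d * L / (4 * N)) / L + d / 4" for x
      by (rule profit_rate_bound[OF u]) (use that in simp)
    have "\<forall>\<^sub>F n in sequentially. \<bar>R x n - N * a / L\<bar> < d" for x
      using near[of x] unfolding rate R_def by (rule eventually_mono) (use that in simp)
    then show ?thesis by blast
  qed
  have "Cauchy (R x)" for x
    unfolding Cauchy_def
  proof (intro allI impI)
    fix d :: real assume "d > 0"
    then obtain m where "\<forall>\<^sub>F n in sequentially. \<bar>R x n - m\<bar> < d / 2"
      using rate[of "d / 2"] by auto
    then obtain M where "\<forall>n\<ge>M. \<bar>R x n - m\<bar> < d / 2"
      unfolding eventually_sequentially by blast
    then show "\<exists>M. \<forall>j\<ge>M. \<forall>n\<ge>M. dist (R x j) (R x n) < d"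
      by (intro exI[of _ M]) (smt (verit) dist_real_def field_sum_of_halves)
  qed
  then obtain l where l: "R x \<longlonglongrightarrow> l x" for x
    unfolding Cauchy_convergent_iff convergent_def by metis
  have "l x = l y" for x y
  proof (rule ccontr)
    assume "l x \<noteq> l y"
    \<comment> \<open>Both limits lie within \<open>d\<close> of a common \<open>m\<close>, hence
      within \<open>2 * d\<close> of each other, yet they are \<open>4 * d\<close> apart.\<close>
    define d where "d = \<bar>l x - l y\<bar> / 4"
    have "d > 0" and d: "\<bar>l x - l y\<bar> = 4 * d"
      using \<open>l x \<noteq> l y\<close> by (simp_all add: d_def)
    from rate[OF \<open>d > 0\<close>] obtain m
      where m: "\<forall>x. \<forall>\<^sub>F n in sequentially. \<bar>R x n - m\<bar> < d" ..
    have near: "\<bar>l z - m\<bar> \<le> d" for z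
    proof (rule tendsto_upperbound)
      show "(\<lambda>n. \<bar>R z n - m\<bar>) \<longlonglongrightarrow> \<bar>l z - m\<bar>"
        using l by (intro tendsto_intros)
      show "\<forall>\<^sub>F n in sequentially. \<bar>R z n - m\<bar> \<le> d"
        by (rule eventually_mono[OF m[rule_format, of z]]) simp
    qed simp
    show False using near[of x] near[of y] d \<open>d > 0\<close> by linarith
  qed
  then have "has_mean_profit K N (l (\<lambda>_. 0))"
    using l unfolding has_mean_profit_def R_def by metis
  then show ?thesis by blast
qed

lemma has_mean_profit_if_contracting:
  assumes "q < 1" and "q \<ge> 0"
    and contr: "\<And>f w. (\<And>c. f (c + 3) = f c) \<Longrightarrow> (\<And>c d. \<bar>f c - f d\<bar> \<le> w) \<Longrightarrow>
      (\<And>c d. \<bar>P f c - P f d\<bar> \<le> q * w)"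
  shows "\<exists>m. has_mean_profit K N m"
proof (rule has_mean_profit_if_approx_poisson)
  \<comment> \<open>\<open>P\<^sup>l id\<close> is an approximate solution: its defect \<open>\<phi> l = P\<^sup>l (P id - id)\<close> becomes constant.\<close>
  fix e :: real assume "e > 0"
  define \<phi> where "\<phi> l c = (P ^^ Suc l) real_of_int c - (P ^^ l) real_of_int c" for l c
  \<comment> \<open>The shift by 3 cancels in the difference \<open>\<phi> l\<close>, which is
    therefore 3-periodic, as \<open>contr\<close> demands.\<close>
  have shift: "(P ^^ l) real_of_int (c + 3) = (P ^^ l) real_of_int c + 3" for l c
    using pull_shift3[of real_of_int 3 "l * L" c] pull_L_mult[of l 0 real_of_int] by simp
  have per: "\<phi> l (c + 3) = \<phi> l c" for l c
    unfolding \<phi>_def shift by simp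
  have step: "\<phi> (Suc l) = P (\<phi> l)" for l
    unfolding \<phi>_def[abs_def] by (simp add: pull_diff)
  have osc: "\<bar>\<phi> l c - \<phi> l d\<bar> \<le> q ^ l * (2 * L)" for l c d
  proof (induction l arbitrary: c d)
    case 0
    have "\<bar>P real_of_int c - c\<bar> \<le> L" for c
      using pull_near[of real_of_int 1 L c] T_id_near by simp
    from this[of c] this[of d] show ?case by (simp add: \<phi>_def)
  next
    case (Suc l)
    show ?case using contr[of "\<phi> l", OF per Suc] by (simp add: step mult.assoc)
  qed
  have "(\<lambda>l. q ^ l * (2 * L)) \<longlonglongrightarrow> 0 * real (2 * L)"
    by (intro tendsto_mult LIMSEQ_realpow_zero assms tendsto_const)
  then have "\<forall>\<^sub>F l in sequentially. q ^ l * (2 * L) < e"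
    using \<open>e > 0\<close> by (intro order_tendstoD) auto
  then obtain l where l: "q ^ l * (2 * L) < e"
    unfolding eventually_sequentially by blast
  have "\<bar>P ((P ^^ l) real_of_int) c - (P ^^ l) real_of_int c - \<phi> l 0\<bar> \<le> e" for c
    using osc[of l c 0] l by (simp add: \<phi>_def)
  moreover have "\<bar>(P ^^ l) real_of_int c - c\<bar> \<le> l * L" for c
    using pull_near[of real_of_int 1 "l * L" c] pull_L_mult[of l 0 real_of_int] T_id_near by simp
  ultimately show "\<exists>u (a::real) b. (\<forall>c. \<bar>P u c - u c - a\<bar> \<le> e) \<and> (\<forall>c. \<bar>u c - real_of_int c\<bar> \<le> b)"
    by blast
qed

section \<open>Contraction and first-order expansion\<close>

lemma T_oscillation:
  assumes "\<And>c d. \<bar>f c - f d\<bar> \<le> w"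
  shows "\<bar>T n f c - T n f d\<bar> \<le> w"
proof -
  have mono: "\<bar>T n f c - k\<bar> \<le> w" if "\<And>c. \<bar>f c - k\<bar> \<le> w" for c k
  proof -
    have "T n f c \<le> T n (\<lambda>_. k + w) c" "T n (\<lambda>_. k - w) c \<le> T n f c"
      by (rule T_mono; use that in \<open>smt (verit)\<close>)+
    then show ?thesis by (simp add: T_def drift_def)
  qed
  \<comment> \<open>\<open>mono\<close> is used twice: first centred at the value
    \<open>f d\<close>, then at the value \<open>T n f c\<close> just obtained.\<close>
  have "\<bar>f d - T n f c\<bar> \<le> w" for d
    using mono[of "f d" c] assms by (simp add: abs_minus_commute)
  from mono[OF this, of d] show ?thesis by (simp add: abs_minus_commute)
qed

text \<open>Game \<open>A'\<close> acts on 3-periodic functions as the scalar \<open>1 - 3/N\<close> modulo constants.\<close>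

lemma T_symmetric_oscillation:
  assumes up1: "\<And>c. up n c = 1" and dn1: "\<And>c. dn n c = 1"
    and per: "\<And>c. f (c + 3) = f c" and w: "\<And>c d. \<bar>f c - f d\<bar> \<le> w"
  shows "\<bar>T n f c - T n f d\<bar> \<le> \<bar>1 - 3 / N\<bar> * w"
proof -
  \<comment> \<open>Three consecutive capitals meet every residue class once, so \<open>S\<close> is
    constant for 3-periodic \<open>f\<close> and drops out of differences.\<close>
  define S where "S c = f (c - 1) + f c + f (c + 1)" for c
  have S1: "S (c + 1) = S c" for c
    using per[of "c - 1"] by (simp add: S_def algebra_simps)
  have S: "S c = S 0" for c
  proof (induction c rule: int_induct[where k = 0])
    case (step2 i)
    then show ?case using S1[of "i - 1"] by simp
  qed (simp_all add: S1)
  have "T n f c = (1 - 3 / N) * f c + S c / N" for c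
    using N_pos by (simp add: S_def T_def drift_def up1 dn1 field_simps)
  then have T: "T n f c = (1 - 3 / N) * f c + S 0 / N" for c
    using S[of c] by metis
  have "T n f c - T n f d = (1 - 3 / N) * (f c - f d)"
    unfolding T by (simp add: right_diff_distrib)
  then show ?thesis
    using w[of c d] by (simp add: abs_mult mult_left_mono)
qed

text \<open>One play of \<open>A'\<close> per period suffices: the inner turns preserve
  3-periodicity and do not increase oscillation, and turn 0, applied last, contracts it.\<close>

lemma has_mean_profit_if_symmetric_start:
  assumes up1: "\<And>c. up 0 c = 1" and dn1: "\<And>c. dn 0 c = 1" and "N \<ge> 2"
  shows "\<exists>m. has_mean_profit K N m"
proof (rule has_mean_profit_if_contracting)
  show "\<bar>1 - 3 / N\<bar> < 1" "\<bar>1 - 3 / N\<bar> \<ge> 0"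
    using \<open>N \<ge> 2\<close> by (auto simp: abs_if field_simps)
  have Suc: "\<bar>pull (Suc n) f c - pull (Suc n) f d\<bar> \<le> \<bar>1 - 3 / N\<bar> * w"
    if "\<And>c. f (c + 3) = f c" "\<And>c d. \<bar>f c - f d\<bar> \<le> w" for n f w c d
    using that
  proof (induction n arbitrary: f)
    case 0
    then show ?case using T_symmetric_oscillation[of 0 f w c d] up1 dn1 by simp
  next
    case (Suc n)
    have "T (Suc n) f (c + 3) = T (Suc n) f c" for c
      using T_shift3[of f 0] Suc.prems(1) by simp
    then show ?case
      using Suc.IH[of "T (Suc n) f"] T_oscillation[OF Suc.prems(2)] by simp
  qed
  show "\<bar>P f c - P f d\<bar> \<le> \<bar>1 - 3 / N\<bar> * w"
    if "\<And>c. f (c + 3) = f c" "\<And>c d. \<bar>f c - f d\<bar> \<le> w" for f w c d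
    using Suc[where f = f, OF that, of "L - 1" c d] L_pos by simp
qed

section \<open>First-order expansion in \<open>1 / N\<close>\<close>

lemma drift_bound:
  assumes "up n c \<le> 1" "dn n c \<le> 1" "\<And>c. \<bar>u (c + 1) - u c\<bar> \<le> b"
  shows "\<bar>drift (up n) (dn n) u c\<bar> \<le> 2 * b"
proof -
  have "\<bar>u (c - 1) - u c\<bar> \<le> b"
    using assms(3)[of "c - 1"] by (simp add: abs_minus_commute)
  then have "\<bar>up n c * (u (c + 1) - u c)\<bar> \<le> 1 * b" "\<bar>dn n c * (u (c - 1) - u c)\<bar> \<le> 1 * b"
    unfolding abs_mult using assms up_nonneg[of n c] dn_nonneg[of n c]
    by (intro mult_mono; simp)+
  then show ?thesis unfolding drift_def by linarith
qed

text \<open>Turn \<open>n\<close> contributes \<open>g / N\<close>, with \<open>g\<close> the drift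
  of \<open>u\<close>. Carrying it back through the \<open>n\<close> earlier turns costs a further
  factor of order \<open>n / N\<close>, and these costs sum to order
  \<open>n^2 / N^2\<close>.\<close>

lemma pull_first_order:
  assumes le1: "\<And>n c. up n c \<le> 1" "\<And>n c. dn n c \<le> 1" and u: "\<And>c. \<bar>u (c + 1) - u c\<bar> \<le> b"
  shows "\<bar>pull n u c - u c - (\<Sum>j<n. drift (up j) (dn j) u c) / N\<bar> \<le> real n ^ 2 * (8 * b) / real N ^ 2"
proof (induction n)
  case (Suc n)
  define g where "g = drift (up n) (dn n) u"
  have g: "\<bar>g c\<bar> \<le> 2 * b" for c
    unfolding g_def by (rule drift_bound) (use assms in auto)
  have dg: "\<bar>g (c + 1) - g c\<bar> \<le> 4 * b" for c
    using g[of c] g[of "c + 1"] by linarith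
  \<comment> \<open>The constant 8 arises by doubling: \<open>2 * b\<close> bounds \<open>g\<close>,
    \<open>4 * b\<close> its increments, \<open>8 * b\<close> its own drift.\<close>
  have "\<bar>T j g c - g c\<bar> \<le> 8 * b / N" for j c
    using drift_bound[of j c g "4 * b"] le1 dg by (simp add: T_def divide_right_mono)
  then have "\<bar>pull n g c - g c\<bar> \<le> n * (8 * b / N)"
    by (rule pull_near)
  then have "\<bar>pull n g c - g c\<bar> / N \<le> n * (8 * b / N) / N"
    by (rule divide_right_mono) simp
  then have 1: "\<bar>pull n g c / N - g c / N\<bar> \<le> n * (8 * b) / real N ^ 2"
    by (simp add: diff_divide_distrib[symmetric] power2_eq_square)
  have "T n u = (\<lambda>c. u c + 1 / N * g c)"
    by (rule ext) (simp add: T_def g_def)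
  then have 2: "pull (Suc n) u c = pull n u c + pull n g c / N"
    using pull_add_scaled[of n u "1 / N" g] by simp
  have 3: "(\<Sum>j<Suc n. drift (up j) (dn j) u c) / N = (\<Sum>j<n. drift (up j) (dn j) u c) / N + g c / N"
    by (simp add: g_def add_divide_distrib)
  have b: "b \<ge> 0" using u[of 0] by linarith
  have "real n ^ 2 * (8 * b) / real N ^ 2 + n * (8 * b) / real N ^ 2
      = (real n ^ 2 + n) * (8 * b) / real N ^ 2"
    by (simp add: add_divide_distrib algebra_simps)
  also have "\<dots> \<le> real (Suc n) ^ 2 * (8 * b) / real N ^ 2"
    by (intro divide_right_mono mult_right_mono) (use b in \<open>auto simp: power2_eq_square algebra_simps\<close>)
  finally show ?case using Suc 1 2 3 by linarith
qed simp

end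

section \<open>The two games\<close>

lemma sum_fun_upd:
  fixes g :: "'b \<Rightarrow> 'c :: ab_group_add"
  assumes "finite A" and "i \<in> A"
  shows "(\<Sum>k\<in>A. g ((x(i := v)) k)) = (\<Sum>k\<in>A. g (x k)) + (g v - g (x i))"
proof -
  have "(\<Sum>k\<in>A - {i}. g ((x(i := v)) k)) = (\<Sum>k\<in>A - {i}. g (x k))"
    by (rule sum.cong) auto
  then show ?thesis
    using sum.remove[OF assms, of "\<lambda>k. g ((x(i := v)) k)"] sum.remove[OF assms, of "\<lambda>k. g (x k)"]
    by (simp add: algebra_simps)
qed

lemma win_prob_nonneg: "\<rho> > 0 \<Longrightarrow> win_prob \<rho> c \<ge> 0"
  by (simp add: win_prob_def)

lemma win_prob_le_1: "\<rho> > 0 \<Longrightarrow> win_prob \<rho> c \<le> 1"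
  by (simp add: win_prob_def add_pos_nonneg)

lemma win_prob_add_3: "win_prob \<rho> (c + 3) = win_prob \<rho> c"
  by (simp add: win_prob_def)

lemma finite_game_B: "N > 0 \<Longrightarrow> finite (set_pmf (game_B \<rho> N x))"
  by (simp add: game_B_def lessThan_empty_iff)

lemma finite_ordered_pairs: "finite {(i, j). i < N \<and> j < N \<and> i \<noteq> (j::nat)}"
  by (rule finite_subset[of _ "{..<N} \<times> {..<N}"]) auto

lemma ordered_pairs_nonempty: "N \<ge> 2 \<Longrightarrow> {(i, j). i < N \<and> j < N \<and> i \<noteq> (j::nat)} \<noteq> {}"
proof -
  assume "N \<ge> 2"
  then have "(0, 1) \<in> {(i, j). i < N \<and> j < N \<and> i \<noteq> (j::nat)}" by simp
  then show ?thesis by blast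
qed

lemma finite_game_A': "N \<ge> 2 \<Longrightarrow> finite (set_pmf (game_A' N x))"
  unfolding game_A'_def set_bind_pmf set_pmf_of_set[OF ordered_pairs_nonempty finite_ordered_pairs]
  by (intro finite_UN_I finite_ordered_pairs) auto

lemma expectation_game_B:
  assumes "N > 0" and "\<rho> > 0"
  shows "measure_pmf.expectation (game_B \<rho> N x) (\<lambda>z. \<Sum>i<N. f (z i)) =
    (\<Sum>i<N. f (x i) + drift (win_prob \<rho>) (\<lambda>c. 1 - win_prob \<rho> c) f (x i) / real N)"
proof -
  let ?w = "\<lambda>i. win_prob \<rho> (x i)" and ?S = "\<Sum>k<N. f (x k)"
  have "measure_pmf.expectation (bind_pmf (bernoulli_pmf (?w i)) (\<lambda>win.
        return_pmf (x(i := x i + (if win then 1 else - 1))))) (\<lambda>z. \<Sum>i<N. f (z i))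
      = ?S + drift (win_prob \<rho>) (\<lambda>c. 1 - win_prob \<rho> c) f (x i)" (is "?E i = _") if "i < N" for i
    using that assms win_prob_nonneg[of \<rho> "x i"] win_prob_le_1[of \<rho> "x i"]
    by (subst pmf_expectation_bind[OF finite _ subset_UNIV])
      (simp_all add: UNIV_bool sum_fun_upd drift_def algebra_simps del: fun_upd_apply)
  then have "measure_pmf.expectation (game_B \<rho> N x) (\<lambda>z. \<Sum>i<N. f (z i)) =
      (\<Sum>i<N. (?S + drift (win_prob \<rho>) (\<lambda>c. 1 - win_prob \<rho> c) f (x i)) / N)"
    unfolding game_B_def using assms
    by (subst pmf_expectation_bind_pmf_of_set) (auto simp: lessThan_empty_iff divide_inverse_commute)
  also have "\<dots> = ?S + (\<Sum>i<N. drift (win_prob \<rho>) (\<lambda>c. 1 - win_prob \<rho> c) f (x i) / N)"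
    using assms by (simp add: add_divide_distrib sum.distrib)
  finally show ?thesis by (simp add: sum.distrib)
qed

text \<open>A transfer changes the sum by a loss term of the giver plus a gain term of the receiver.
  Each player has either role with probability \<open>1 / N\<close>, so only marginals enter
  although the two steps are dependent.\<close>

lemma expectation_game_A':
  assumes "N \<ge> 2"
  shows "measure_pmf.expectation (game_A' N x) (\<lambda>z. \<Sum>i<N. f (z i)) =
    (\<Sum>i<N. f (x i) + drift (\<lambda>_. 1) (\<lambda>_. 1) f (x i) / real N)"
proof -
  let ?Q = "{(i, j). i < N \<and> j < N \<and> i \<noteq> (j::nat)}"
  let ?S = "\<Sum>k<N. f (x k)"
  define g where "g i = f (x i - 1) - f (x i)" for i
  define h where "h i = f (x i + 1) - f (x i)" for i
  have Q: "?Q = Sigma {..<N} (\<lambda>i. {..<N} - {i})"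
    by auto
  have card: "real (card ?Q) = real N * (real N - 1)"
    unfolding Q using assms by (subst card_SigmaI) (auto simp: of_nat_diff)
  have "(\<Sum>k<N. f ((x(i := x i - 1, j := x j + 1)) k)) = ?S + (g i + h j)"
    if "i < N" "j < N" "i \<noteq> j" for i j
    using that by (simp add: sum_fun_upd g_def h_def del: fun_upd_apply) (simp add: fun_upd_def)
  then have "measure_pmf.expectation (game_A' N x) (\<lambda>z. \<Sum>i<N. f (z i)) =
      (\<Sum>(i, j)\<in>?Q. (?S + (g i + h j)) / real (card ?Q))"
    unfolding game_A'_def using ordered_pairs_nonempty[OF assms]
    by (subst pmf_expectation_bind_pmf_of_set)
      (auto simp: finite_ordered_pairs divide_inverse_commute intro!: sum.cong)
  also have "\<dots> = (\<Sum>i<N. \<Sum>j\<in>{..<N} - {i}. (?S + (g i + h j)) / real (card ?Q))"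
    unfolding Q by (subst sum.Sigma) auto
  also have "\<dots> = (\<Sum>i<N. \<Sum>j\<in>{..<N} - {i}. ?S + (g i + h j)) / real (card ?Q)"
    by (simp add: sum_divide_distrib)
  \<comment> \<open>For a fixed giver there are \<open>N - 1\<close> receivers, and their gains sum
    to the full total minus \<open>h i\<close>.\<close>
  also have "(\<Sum>i<N. \<Sum>j\<in>{..<N} - {i}. ?S + (g i + h j)) =
      (\<Sum>i<N. (real N - 1) * (?S + g i) + (sum h {..<N} - h i))"
    using assms by (intro sum.cong) (auto simp: sum.distrib sum_diff1 of_nat_diff algebra_simps)
  also have "\<dots> = (real N * (real N - 1)) * ?S + (real N - 1) * (sum g {..<N} + sum h {..<N})"
    by (simp add: sum.distrib sum_subtractf sum_distrib_left[symmetric] algebra_simps)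
  also have "\<dots> / real (card ?Q) = ?S + (sum g {..<N} + sum h {..<N}) / N"
    unfolding card using assms by (simp add: field_simps)
  also have "(sum g {..<N} + sum h {..<N}) / N = (\<Sum>i<N. drift (\<lambda>_. 1) (\<lambda>_. 1) f (x i) / N)"
    by (simp add: drift_def g_def h_def sum.distrib[symmetric] sum_divide_distrib add.commute)
  finally show ?thesis
    by (simp add: sum.distrib)
qed

lemma marginal_chain_mixture:
  assumes "N \<ge> 2" and "\<rho> > 0" and \<gamma>: "0 \<le> \<gamma>" "\<gamma> \<le> 1"
  shows "marginal_chain (random_mixture \<rho> \<gamma> N) N 1
    (\<lambda>_ c. \<gamma> + (1 - \<gamma>) * win_prob \<rho> c) (\<lambda>_ c. \<gamma> + (1 - \<gamma>) * (1 - win_prob \<rho> c))"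
proof
  fix n c x and f :: "int \<Rightarrow> real"
  note w = win_prob_nonneg[OF \<open>\<rho> > 0\<close>, of c] win_prob_le_1[OF \<open>\<rho> > 0\<close>, of c]
  show "0 \<le> \<gamma> + (1 - \<gamma>) * win_prob \<rho> c" "0 \<le> \<gamma> + (1 - \<gamma>) * (1 - win_prob \<rho> c)"
    using w \<gamma> by simp_all
  have "(\<gamma> + (1 - \<gamma>) * win_prob \<rho> c) + (\<gamma> + (1 - \<gamma>) * (1 - win_prob \<rho> c)) = 1 + \<gamma>"
    by (simp add: algebra_simps)
  then show "(\<gamma> + (1 - \<gamma>) * win_prob \<rho> c) + (\<gamma> + (1 - \<gamma>) * (1 - win_prob \<rho> c)) \<le> real N"
    using assms by simp
  show "finite (set_pmf (random_mixture \<rho> \<gamma> N n x))"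
    using assms finite_game_A' finite_game_B by (auto simp: random_mixture_def)
  have "measure_pmf.expectation (random_mixture \<rho> \<gamma> N n x) (\<lambda>z. \<Sum>i<N. f (z i)) =
      \<gamma> * measure_pmf.expectation (game_A' N x) (\<lambda>z. \<Sum>i<N. f (z i)) +
      (1 - \<gamma>) * measure_pmf.expectation (game_B \<rho> N x) (\<lambda>z. \<Sum>i<N. f (z i))"
    unfolding random_mixture_def using assms finite_game_A' finite_game_B
    by (subst pmf_expectation_bind[OF finite _ subset_UNIV]) (auto simp: UNIV_bool)
  also have "\<dots> = (\<Sum>i<N. f (x i) + drift (\<lambda>c. \<gamma> + (1 - \<gamma>) * win_prob \<rho> c)
      (\<lambda>c. \<gamma> + (1 - \<gamma>) * (1 - win_prob \<rho> c)) f (x i) / real N)"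
    using assms
    by (simp add: expectation_game_A' expectation_game_B sum_distrib_left sum.distrib[symmetric])
      (intro sum.cong; simp add: drift_def field_simps)
  finally show "measure_pmf.expectation (random_mixture \<rho> \<gamma> N n x) (\<lambda>z. \<Sum>i<N. f (z i)) = \<dots>" .
qed (use assms in \<open>auto simp: win_prob_add_3\<close>)

lemma marginal_chain_pattern:
  assumes "N \<ge> 2" and "\<rho> > 0" and "r + s > 0"
  shows "marginal_chain (nonrandom_pattern \<rho> r s N) N (r + s)
    (\<lambda>n c. if n mod (r + s) < r then 1 else win_prob \<rho> c)
    (\<lambda>n c. if n mod (r + s) < r then 1 else 1 - win_prob \<rho> c)"
  using assms
  by unfold_locales
    (auto simp: nonrandom_pattern_def finite_game_A' finite_game_B win_prob_nonneg win_prob_le_1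
      expectation_game_A' expectation_game_B win_prob_add_3)

section \<open>Explicit solution and the limit\<close>

text \<open>The identity plus a 3-periodic correction turns the equation into three linear ones. The
  same \<open>u\<close> serves both strategies: the left side is the drift summed over a pattern
  period, and divided by \<open>r + s\<close> it is the mixture's drift.\<close>

lemma poisson_solution:
  fixes r s \<rho> :: real
  assumes "r > 0" and "s > 0" and "\<rho> > 0"
  defines "D \<equiv> 9 * r\<^sup>2 * (1 + \<rho>)\<^sup>2 * (1 + \<rho>\<^sup>2) + 9 * r * s * (1 + \<rho>)\<^sup>2 * (1 + \<rho>\<^sup>2)
    + 2 * s\<^sup>2 * (1 + \<rho> + \<rho>\<^sup>2)\<^sup>2"
  obtains u :: "int \<Rightarrow> real" and b where "\<And>c. \<bar>u c - c\<bar> \<le> b"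
    and "\<And>c. r * drift (\<lambda>_. 1) (\<lambda>_. 1) u c + s * drift (win_prob \<rho>) (\<lambda>c. 1 - win_prob \<rho> c) u c
      = (r + s) * (3 * r * s * (1 - \<rho>) ^ 3 * (1 + \<rho>) / D)"
proof -
  \<comment> \<open>\<open>v\<close>, \<open>w\<close> and \<open>m\<close> are the Cramer solution of the three equations, one per residue class,
     with \<open>u 0 = 0\<close> fixing the additive constant.\<close>
  define t where "t = 2 * s * (1 - \<rho>) * (1 + \<rho> + \<rho>\<^sup>2) / D"
  define v where "v = t * (3 * r * (1 + \<rho>) + s * (2 + \<rho>))"
  define w where "w = t * (3 * r * (1 + \<rho>) + s * (1 + 2 * \<rho>))"
  define m where "m = 3 * r * s * (1 - \<rho>) ^ 3 * (1 + \<rho>) / D"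
  define u :: "int \<Rightarrow> real" where
    "u c = c + (if c mod 3 = 1 then v else if c mod 3 = 2 then w else 0)" for c
  have "D > 0"
    unfolding D_def using assms by (intro add_pos_pos mult_pos_pos zero_less_power) auto
  have "1 + \<rho>\<^sup>2 > 0" "1 + \<rho> > 0" using assms by (auto intro: add_pos_nonneg)
  have t: "t * D = 2 * s * (1 - \<rho>) * (1 + \<rho> + \<rho>\<^sup>2)" and m: "m * D = 3 * r * s * (1 - \<rho>) ^ 3 * (1 + \<rho>)"
    using \<open>D > 0\<close> by (simp_all add: t_def m_def)
  \<comment> \<open>After multiplication by \<open>D\<close>, the values of \<open>t * D\<close> and
    \<open>m * D\<close> turn each equation into a polynomial identity.\<close>
  have cancel_D: "x = y" if "x * D = y * D" for x y
    using that \<open>D > 0\<close> by simp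
  have E0: "(r * (1 + \<rho>\<^sup>2) + s * \<rho>\<^sup>2) * (1 + v) + (r * (1 + \<rho>\<^sup>2) + s) * (w - 1) = (r + s) * m * (1 + \<rho>\<^sup>2)"
  proof (rule cancel_D)
    have "((r * (1 + \<rho>\<^sup>2) + s * \<rho>\<^sup>2) * (1 + v) + (r * (1 + \<rho>\<^sup>2) + s) * (w - 1)) * D =
        (s * \<rho>\<^sup>2 - s) * D + t * D * ((r * (1 + \<rho>\<^sup>2) + s * \<rho>\<^sup>2) * (3 * r * (1 + \<rho>) + s * (2 + \<rho>)) + (r * (1 + \<rho>\<^sup>2) + s) * (3 * r * (1 + \<rho>) + s * (1 + 2 * \<rho>)))"
      unfolding v_def w_def by (simp add: algebra_simps)
    also have "\<dots> = (r + s) * (m * D) * (1 + \<rho>\<^sup>2)"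
      unfolding t m unfolding D_def by algebra
    finally show "((r * (1 + \<rho>\<^sup>2) + s * \<rho>\<^sup>2) * (1 + v) + (r * (1 + \<rho>\<^sup>2) + s) * (w - 1)) * D = (r + s) * m * (1 + \<rho>\<^sup>2) * D"
      by (simp only: ac_simps)
  qed
  have E1: "(r * (1 + \<rho>) + s) * (1 + w - v) + (r * (1 + \<rho>) + s * \<rho>) * (- 1 - v) = (r + s) * m * (1 + \<rho>)"
  proof (rule cancel_D)
    have "((r * (1 + \<rho>) + s) * (1 + w - v) + (r * (1 + \<rho>) + s * \<rho>) * (- 1 - v)) * D =
        (s - s * \<rho>) * D + t * D * ((r * (1 + \<rho>) + s) * ((3 * r * (1 + \<rho>) + s * (1 + 2 * \<rho>)) - (3 * r * (1 + \<rho>) + s * (2 + \<rho>))) - (r * (1 + \<rho>) + s * \<rho>) * (3 * r * (1 + \<rho>) + s * (2 + \<rho>)))"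
      unfolding v_def w_def by (simp add: algebra_simps)
    also have "\<dots> = (r + s) * (m * D) * (1 + \<rho>)"
      unfolding t m unfolding D_def by algebra
    finally show "((r * (1 + \<rho>) + s) * (1 + w - v) + (r * (1 + \<rho>) + s * \<rho>) * (- 1 - v)) * D = (r + s) * m * (1 + \<rho>) * D"
      by (simp only: ac_simps)
  qed
  have E2: "(r * (1 + \<rho>) + s) * (1 - w) + (r * (1 + \<rho>) + s * \<rho>) * (v - w - 1) = (r + s) * m * (1 + \<rho>)"
  proof (rule cancel_D)
    have "((r * (1 + \<rho>) + s) * (1 - w) + (r * (1 + \<rho>) + s * \<rho>) * (v - w - 1)) * D =
        (s - s * \<rho>) * D + t * D * ((r * (1 + \<rho>) + s * \<rho>) * ((3 * r * (1 + \<rho>) + s * (2 + \<rho>)) - (3 * r * (1 + \<rho>) + s * (1 + 2 * \<rho>))) - (r * (1 + \<rho>) + s) * (3 * r * (1 + \<rho>) + s * (1 + 2 * \<rho>)))"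
      unfolding v_def w_def by (simp add: algebra_simps)
    also have "\<dots> = (r + s) * (m * D) * (1 + \<rho>)"
      unfolding t m unfolding D_def by algebra
    finally show "((r * (1 + \<rho>) + s) * (1 - w) + (r * (1 + \<rho>) + s * \<rho>) * (v - w - 1)) * D = (r + s) * m * (1 + \<rho>) * D"
      by (simp only: ac_simps)
  qed
  \<comment> \<open>This restores the denominator \<open>k\<close>, which is
    \<open>1 + \<rho>\<^sup>2\<close> or \<open>1 + \<rho>\<close> and was cleared in
    \<open>E0\<close>, \<open>E1\<close> and \<open>E2\<close>.\<close>
  have drift: "r * drift (\<lambda>_. 1) (\<lambda>_. 1) u c + s * drift (win_prob \<rho>) (\<lambda>c. 1 - win_prob \<rho> c) u c = x"
    if "win_prob \<rho> c = p / k" "1 - win_prob \<rho> c = q / k" "k > 0"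
      and "(r * k + s * p) * (u (c + 1) - u c) + (r * k + s * q) * (u (c - 1) - u c) = x * k" for c p q k x
  proof -
    have "x = ((r * k + s * p) * (u (c + 1) - u c) + (r * k + s * q) * (u (c - 1) - u c)) / k"
      using that by simp
    also have "\<dots> = r * (u (c + 1) - u c + (u (c - 1) - u c))
        + s * (p / k * (u (c + 1) - u c) + q / k * (u (c - 1) - u c))"
      using \<open>k > 0\<close> by (simp add: add_divide_distrib diff_divide_distrib algebra_simps)
    finally show ?thesis
      unfolding drift_def that(2) unfolding that(1) by simp
  qed
  have "r * drift (\<lambda>_. 1) (\<lambda>_. 1) u c + s * drift (win_prob \<rho>) (\<lambda>c. 1 - win_prob \<rho> c) u c = (r + s) * m" for c
  proof -
    have "c mod 3 = 0 \<or> c mod 3 = 1 \<or> c mod 3 = 2" by presburger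
    then consider "c mod 3 = 0" | "c mod 3 = 1" | "c mod 3 = 2" by blast
    then show ?thesis
    proof cases
      case 1
      then have "(c + 1) mod 3 = 1" "(c - 1) mod 3 = 2" by presburger+
      with 1 have "u (c + 1) - u c = 1 + v" "u (c - 1) - u c = w - 1" by (simp_all add: u_def)
      moreover have "win_prob \<rho> c = \<rho>\<^sup>2 / (1 + \<rho>\<^sup>2)" "1 - win_prob \<rho> c = 1 / (1 + \<rho>\<^sup>2)"
        using 1 \<open>1 + \<rho>\<^sup>2 > 0\<close> by (simp_all add: win_prob_def field_simps)
      ultimately show ?thesis
        using E0 \<open>1 + \<rho>\<^sup>2 > 0\<close> by (intro drift[where p = "\<rho>\<^sup>2" and q = 1 and k = "1 + \<rho>\<^sup>2"]) (simp_all only: mult_1_right)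
    next
      case 2
      then have "(c + 1) mod 3 = 2" "(c - 1) mod 3 = 0" by presburger+
      with 2 have "u (c + 1) - u c = 1 + w - v" "u (c - 1) - u c = - 1 - v" by (simp_all add: u_def)
      moreover have "win_prob \<rho> c = 1 / (1 + \<rho>)" "1 - win_prob \<rho> c = \<rho> / (1 + \<rho>)"
        using 2 assms by (simp_all add: win_prob_def field_simps)
      ultimately show ?thesis
        using E1 \<open>1 + \<rho> > 0\<close> by (intro drift[where p = 1 and q = \<rho> and k = "1 + \<rho>"]) (simp_all only: mult_1_right)
    next
      case 3
      then have "(c + 1) mod 3 = 0" "(c - 1) mod 3 = 1" by presburger+
      with 3 have "u (c + 1) - u c = 1 - w" "u (c - 1) - u c = v - w - 1" by (simp_all add: u_def)
      moreover have "win_prob \<rho> c = 1 / (1 + \<rho>)" "1 - win_prob \<rho> c = \<rho> / (1 + \<rho>)"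
        using 3 assms by (simp_all add: win_prob_def field_simps)
      ultimately show ?thesis
        using E2 \<open>1 + \<rho> > 0\<close> by (intro drift[where p = 1 and q = \<rho> and k = "1 + \<rho>"]) (simp_all only: mult_1_right)
    qed
  qed
  moreover have "\<bar>u c - c\<bar> \<le> \<bar>v\<bar> + \<bar>w\<bar>" for c
    by (simp add: u_def)
  ultimately show ?thesis
    using that unfolding m_def by blast
qed

section \<open>Comparison of the two mean profits\<close>

lemma mean_profit_eqI: "has_mean_profit K N m \<Longrightarrow> mean_profit K N = m"
  unfolding mean_profit_def has_mean_profit_def by (rule the_equality) (blast intro: LIMSEQ_unique)+

theorem mainTheorem4:
  fixes r s N :: nat and \<rho> :: real
  assumes "r \<ge> 1" and "s \<ge> 1" and "N \<ge> 2" and "\<rho> > 0"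
  shows "(\<exists>m. has_mean_profit (random_mixture \<rho> (real r / real (r + s)) N) N m) \<and>
         (\<forall>M\<ge>2. \<exists>m. has_mean_profit (nonrandom_pattern \<rho> r s M) M m) \<and>
         (\<lambda>M. mu_pattern \<rho> r s M) \<longlonglongrightarrow> mu_mixture \<rho> (real r / real (r + s)) N \<and>
         mu_mixture \<rho> (real r / real (r + s)) N =
           3 * real r * real s * (1 - \<rho>) ^ 3 * (1 + \<rho>) /
           (9 * (real r)\<^sup>2 * (1 + \<rho>)\<^sup>2 * (1 + \<rho>\<^sup>2)
            + 9 * real r * real s * (1 + \<rho>)\<^sup>2 * (1 + \<rho>\<^sup>2)
            + 2 * (real s)\<^sup>2 * (1 + \<rho> + \<rho>\<^sup>2)\<^sup>2)"
proof -
  define m where "m = 3 * real r * real s * (1 - \<rho>) ^ 3 * (1 + \<rho>) /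
           (9 * (real r)\<^sup>2 * (1 + \<rho>)\<^sup>2 * (1 + \<rho>\<^sup>2)
            + 9 * real r * real s * (1 + \<rho>)\<^sup>2 * (1 + \<rho>\<^sup>2)
            + 2 * (real s)\<^sup>2 * (1 + \<rho> + \<rho>\<^sup>2)\<^sup>2)"
  define L where "L = r + s"
  define \<gamma> where "\<gamma> = real r / real L"
  obtain u :: "int \<Rightarrow> real" and b where u_near: "\<And>c. \<bar>u c - c\<bar> \<le> b"
    and u_eq: "\<And>c. r * drift (\<lambda>_. 1) (\<lambda>_. 1) u c + s * drift (win_prob \<rho>) (\<lambda>c. 1 - win_prob \<rho> c) u c
      = L * m"
    using poisson_solution[of "real r" "real s" \<rho>] assms unfolding m_def L_def by auto
  have L: "real L > 0" using assms by (simp add: L_def)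
  have \<gamma>: "0 \<le> \<gamma>" "\<gamma> \<le> 1" "(1 - \<gamma>) = s / L"
    using L by (simp_all add: \<gamma>_def L_def field_simps)

  interpret mix: marginal_chain "random_mixture \<rho> \<gamma> N" N 1
    "\<lambda>_ c. \<gamma> + (1 - \<gamma>) * win_prob \<rho> c" "\<lambda>_ c. \<gamma> + (1 - \<gamma>) * (1 - win_prob \<rho> c)"
    by (rule marginal_chain_mixture) (use assms \<gamma> in auto)
  have "drift (\<lambda>c. \<gamma> + (1 - \<gamma>) * win_prob \<rho> c) (\<lambda>c. \<gamma> + (1 - \<gamma>) * (1 - win_prob \<rho> c)) u c
      = (r * drift (\<lambda>_. 1) (\<lambda>_. 1) u c + s * drift (win_prob \<rho>) (\<lambda>c. 1 - win_prob \<rho> c) u c) / L" for c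
    unfolding \<gamma>(3) unfolding \<gamma>_def drift_def using L by (simp add: field_simps)
  then have "mix.pull 1 u c = u c + m / N" for c
    unfolding u_eq using L by (simp add: mix.T_def)
  from mix.has_mean_profit_if_poisson[OF this u_near]
  have mix: "has_mean_profit (random_mixture \<rho> \<gamma> N) N m"
    using assms by simp

  have u_step: "\<bar>u (c + 1) - u c\<bar> \<le> 1 + 2 * b" for c
    using u_near[of c] u_near[of "c + 1"] by simp
  \<comment> \<open>\<open>B / M\<close> is \<open>M * e / L\<close> for the first-order remainder
    \<open>e\<close> of \<open>u\<close> over \<open>L\<close> turns with \<open>M\<close>
    players.\<close>
  define B where "B = real L * (8 * (1 + 2 * b))"
  have pattern: "\<exists>m'. has_mean_profit (nonrandom_pattern \<rho> r s M) M m' \<and> \<bar>m' - m\<bar> \<le> B / M"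
    if M: "M \<ge> 2" for M
  proof -
    interpret pat: marginal_chain "nonrandom_pattern \<rho> r s M" M L
      "\<lambda>n c. if n mod L < r then 1 else win_prob \<rho> c"
      "\<lambda>n c. if n mod L < r then 1 else 1 - win_prob \<rho> c"
      unfolding L_def by (rule marginal_chain_pattern) (use assms M in auto)
    \<comment> \<open>Turn 0 is a play of \<open>A'\<close> because
      \<open>r \<ge> 1\<close>.\<close>
    obtain m' where m': "has_mean_profit (nonrandom_pattern \<rho> r s M) M m'"
      using pat.has_mean_profit_if_symmetric_start assms M by auto
    let ?d = "\<lambda>j c. drift (\<lambda>c. if j mod L < r then 1 else win_prob \<rho> c)
        (\<lambda>c. if j mod L < r then 1 else 1 - win_prob \<rho> c) u c"
    \<comment> \<open>To first order only the numbers \<open>r\<close> and \<open>s\<close> of plays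
      matter, not their order.\<close>
    have "(\<Sum>j<L. ?d j c) = L * m" for c
    proof -
      have "(\<Sum>j<L. ?d j c) = (\<Sum>j\<in>{..<r} \<union> {r..<L}. ?d j c)"
        by (rule sum.cong) (auto simp: L_def)
      also have "\<dots> = (\<Sum>j<r. ?d j c) + (\<Sum>j\<in>{r..<L}. ?d j c)"
        by (rule sum.union_disjoint) auto
      also have "(\<Sum>j<r. ?d j c) = (\<Sum>j<r. drift (\<lambda>_. 1) (\<lambda>_. 1) u c)"
        by (rule sum.cong) (auto simp: L_def)
      also have "(\<Sum>j\<in>{r..<L}. ?d j c) =
          (\<Sum>j\<in>{r..<L}. drift (win_prob \<rho>) (\<lambda>c. 1 - win_prob \<rho> c) u c)"
        by (rule sum.cong) auto
      finally show ?thesis using u_eq[of c] by (simp add: L_def)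
    qed
    then have "\<bar>pat.pull L u c - u c - L * m / M\<bar> \<le> real L ^ 2 * (8 * (1 + 2 * b)) / real M ^ 2" for c
      using pat.pull_first_order[of u "1 + 2 * b" L c] u_step assms
      by (simp add: win_prob_le_1 win_prob_nonneg)
    from pat.mean_profit_close[OF m' this u_near]
    have "\<bar>m' - m\<bar> \<le> B / M"
      using L M by (simp add: B_def power2_eq_square)
    with m' show ?thesis by blast
  qed
  have "(\<lambda>M. mu_pattern \<rho> r s M) \<longlonglongrightarrow> m"
  proof (rule LIM_zero_cancel, rule Lim_null_comparison)
    have "norm (mu_pattern \<rho> r s M - m) \<le> B / M" if "M \<ge> 2" for M
      using pattern[OF that] mean_profit_eqI by (fastforce simp: mu_pattern_def)
    then show "\<forall>\<^sub>F M in sequentially. norm (mu_pattern \<rho> r s M - m) \<le> B / M"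
      unfolding eventually_sequentially by blast
  qed (rule lim_const_over_n)
  moreover have "mu_mixture \<rho> \<gamma> N = m"
    unfolding mu_mixture_def using mix by (rule mean_profit_eqI)
  ultimately show ?thesis
    using mix pattern unfolding m_def[symmetric] L_def[symmetric] \<gamma>_def[symmetric] by auto
qed

end
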